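(* Let $r\geq 1$ be an integer and let $G$ be a graph on $n$ vertices with $\delta(G)\geq r$ and $\mathrm{girth}(G)>r+1$. Then $\mathrm{gon}_r(G)\leq n-\alpha_r(G)$.
   Context: A graph is a finite, connected, undirected multigraph (parallel edges allowed, loops not allowed). $\delta(G)$ is the minimum valence of a vertex; the girth is the minimum length of a cycle (a pair of parallel edges is a cycle of length $2$). For vertices $u,v$, $d(u,v)$ is the graph distance. The $k$-independence number $\alpha_k(G)$ is the maximum size of a set $S\subseteq V(G)$ with $d(u,v)>k$ for all distinct $u,v\in S$. A divisor is a formal integer combination $D=\sum_v D(v)\,(v)$ of vertices; $\deg D=\sum_v D(v)$; $D$ is effective if $D(v)\geq 0$ for all $v$. Firing a vertex $v$ transforms $D$ into $D'$ with $D'(v)=D(v)-\mathrm{val}(v)$ and $D'(w)=D(w)+(\text{number of edges between } v \text{ and } w)$ for $w\neq v$; two divisors are linearly equivalent if one is obtained from the other by a finite sequence of firings. The rank $r(D)$ is $-1$ if $D$ is not equivalent to an effective divisor, and otherwise the largest integer $r\ge 0$ such that for every effective divisor $E$ of degree $r$, $D-E$ is linearly equivalent to an effective divisor. The $r$-th gonality $\mathrm{gon}_r(G)$ is the minimum degree of a divisor of rank at least $r$ on $G$. *)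

theory Defs
  imports Main "HOL-Library.Extended_Nat"
begin

text \<open>Undirected multigraphs: edges are objects of their own, so that parallel edges are distinct
  edges with the same set of endpoints.\<close>

record ('v, 'e) mgraph =
  verts :: "'v set"
  edges :: "'e set"
  ends :: "'e \<Rightarrow> 'v set"

fun walk :: "('v, 'e) mgraph \<Rightarrow> 'v \<Rightarrow> 'e list \<Rightarrow> 'v \<Rightarrow> bool" where
  "walk G u [] v \<longleftrightarrow> u \<in> verts G \<and> u = v"
| "walk G u (e # es) v \<longleftrightarrow> e \<in> edges G \<and> (\<exists>w. ends G e = {u, w} \<and> walk G w es v)"

definition connected_mgraph :: "('v, 'e) mgraph \<Rightarrow> bool" where
  "connected_mgraph G \<longleftrightarrow> verts G \<noteq> {} \<and> (\<forall>u\<in>verts G. \<forall>v\<in>verts G. \<exists>es. walk G u es v)"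

text \<open>Each edge has exactly two endpoints, which excludes loops.\<close>

definition multigraph :: "('v, 'e) mgraph \<Rightarrow> bool" where
  "multigraph G \<longleftrightarrow> finite (verts G) \<and> finite (edges G) \<and>
     (\<forall>e\<in>edges G. ends G e \<subseteq> verts G \<and> card (ends G e) = 2) \<and> connected_mgraph G"

definition edges_between :: "('v, 'e) mgraph \<Rightarrow> 'v \<Rightarrow> 'v \<Rightarrow> nat" where
  "edges_between G v w = card {e \<in> edges G. ends G e = {v, w}}"

definition valence :: "('v, 'e) mgraph \<Rightarrow> 'v \<Rightarrow> nat" where
  "valence G v = card {e \<in> edges G. v \<in> ends G e}"

definition min_valence :: "('v, 'e) mgraph \<Rightarrow> nat" where
  "min_valence G = Min (valence G ` verts G)"

text \<open>A cycle visits the distinct vertices \<open>vs\<close> in order, using the distinct edges \<open>es\<close>;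
  two parallel edges form a cycle of length 2.\<close>

definition is_cycle :: "('v, 'e) mgraph \<Rightarrow> 'v list \<Rightarrow> 'e list \<Rightarrow> bool" where
  "is_cycle G vs es \<longleftrightarrow> length vs = length es \<and> 2 \<le> length es \<and>
     distinct vs \<and> distinct es \<and> set vs \<subseteq> verts G \<and> set es \<subseteq> edges G \<and>
     (\<forall>i<length es. ends G (es ! i) = {vs ! i, vs ! (Suc i mod length vs)})"

text \<open>The girth of an acyclic graph is \<open>\<infinity>\<close>, the infimum of the empty set.\<close>

definition girth :: "('v, 'e) mgraph \<Rightarrow> enat" where
  "girth G = Inf {enat (length es) | vs es. is_cycle G vs es}"

definition gdist :: "('v, 'e) mgraph \<Rightarrow> 'v \<Rightarrow> 'v \<Rightarrow> nat" where
  "gdist G u v = (LEAST n. \<exists>es. walk G u es v \<and> length es = n)"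

definition indep_number :: "nat \<Rightarrow> ('v, 'e) mgraph \<Rightarrow> nat" where
  "indep_number k G =
     Max {card S | S. S \<subseteq> verts G \<and> (\<forall>u\<in>S. \<forall>v\<in>S. u \<noteq> v \<longrightarrow> k < gdist G u v)}"

text \<open>Divisors are integer-valued functions that vanish outside the vertex set.\<close>

definition divisor :: "('v, 'e) mgraph \<Rightarrow> ('v \<Rightarrow> int) \<Rightarrow> bool" where
  "divisor G D \<longleftrightarrow> (\<forall>v. v \<notin> verts G \<longrightarrow> D v = 0)"

definition deg :: "('v, 'e) mgraph \<Rightarrow> ('v \<Rightarrow> int) \<Rightarrow> int" where
  "deg G D = (\<Sum>v\<in>verts G. D v)"

definition effective :: "('v, 'e) mgraph \<Rightarrow> ('v \<Rightarrow> int) \<Rightarrow> bool" where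
  "effective G D \<longleftrightarrow> divisor G D \<and> (\<forall>v\<in>verts G. 0 \<le> D v)"

definition fire :: "('v, 'e) mgraph \<Rightarrow> 'v \<Rightarrow> ('v \<Rightarrow> int) \<Rightarrow> ('v \<Rightarrow> int)" where
  "fire G v D =
     (\<lambda>w. if w = v then D v - int (valence G v) else D w + int (edges_between G v w))"

text \<open>On a multigraph this relation is symmetric, because firing every vertex once
  leaves a divisor unchanged.\<close>

definition lin_equiv :: "('v, 'e) mgraph \<Rightarrow> ('v \<Rightarrow> int) \<Rightarrow> ('v \<Rightarrow> int) \<Rightarrow> bool" where
  "lin_equiv G = (\<lambda>D D'. \<exists>v\<in>verts G. D' = fire G v D)\<^sup>*\<^sup>*"

definition equiv_effective :: "('v, 'e) mgraph \<Rightarrow> ('v \<Rightarrow> int) \<Rightarrow> bool" where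
  "equiv_effective G D \<longleftrightarrow> (\<exists>D'. effective G D' \<and> lin_equiv G D D')"

text \<open>The \<open>GREATEST\<close> exists on a multigraph: \<open>k = 0\<close> qualifies whenever the second
  branch is reached, and \<open>k\<close> cannot exceed the degree of \<open>D\<close>, which firing preserves.\<close>

definition rank :: "('v, 'e) mgraph \<Rightarrow> ('v \<Rightarrow> int) \<Rightarrow> int" where
  "rank G D =
     (if \<not> equiv_effective G D then -1
      else int (GREATEST k::nat. \<forall>E. effective G E \<and> deg G E = int k \<longrightarrow>
                                   equiv_effective G (\<lambda>v. D v - E v)))"

definition gonality :: "nat \<Rightarrow> ('v, 'e) mgraph \<Rightarrow> int" where
  "gonality r G = (LEAST d::int. \<exists>D. divisor G D \<and> int r \<le> rank G D \<and> deg G D = d)"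

end

theory Submission
  imports Defs
begin

text \<open>Let \<open>S\<close> be a maximum set of vertices at pairwise distance more than \<open>r\<close>, put one chip on every
  vertex outside \<open>S\<close>, and subtract an effective divisor \<open>E\<close> of degree \<open>r\<close>, leaving \<open>F\<close>. Burn
  vertices one after another, a vertex catching fire when it has fewer chips than burnt edges.
  If \<open>A\<close> has burnt, counting edges in burning order gives \<open>|A| - e(A) \<le> E(A) - |A - S|\<close>.
  As long as \<open>|A| \<le> r + 1\<close>, the girth and the distances in \<open>S\<close> yield \<open>|A \<inter> S| + e(A) \<le> |A|\<close>,
  hence \<open>|A| \<le> E(A) \<le> r\<close>. So the fire never exceeds \<open>r\<close> vertices, and when it stops at \<open>W\<close>,
  firing the complement of \<open>W\<close> once makes \<open>F\<close> effective: unburnt vertices can afford it, and the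
  same count for \<open>W - {u}\<close> bounds the debt at a burnt vertex \<open>u\<close> by the number of edges leaving
  \<open>W\<close> at \<open>u\<close>, since the valence of \<open>u\<close> is at least \<open>r\<close>.\<close>

section \<open>Edge counts\<close>

lemma edges_between_commute: "edges_between G v w = edges_between G w v"
  by (simp add: edges_between_def insert_commute)

lemma edges_between_self:
  assumes "multigraph G"
  shows "edges_between G v v = 0"
proof -
  have "{e \<in> edges G. ends G e = {v, v}} = {}"
    using assms by (auto simp: multigraph_def)
  then show ?thesis
    unfolding edges_between_def by (simp only: card.empty)
qed

lemma edges_between_outside:
  assumes "multigraph G" "w \<notin> verts G"
  shows "edges_between G v w = 0"
proof -
  have "{e \<in> edges G. ends G e = {v, w}} = {}"
    using assms by (auto simp: multigraph_def)
  then show ?thesis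
    unfolding edges_between_def by (simp only: card.empty)
qed

lemma edges_between_posE:
  assumes "0 < edges_between G v w"
  obtains e where "e \<in> edges G" "ends G e = {v, w}"
  using assms unfolding edges_between_def card_gt_0_iff by blast

lemma valence_eq_sum:
  assumes G: "multigraph G"
  shows "valence G v = (\<Sum>w\<in>verts G. edges_between G w v)"
proof -
  have fin: "finite (verts G)" "finite (edges G)"
    using G by (auto simp: multigraph_def)
  have *: "{e \<in> edges G. v \<in> ends G e} = (\<Union>w\<in>verts G. {e \<in> edges G. ends G e = {w, v}})"
  proof (intro equalityI subsetI)
    fix e assume e: "e \<in> {e \<in> edges G. v \<in> ends G e}"
    then have "card (ends G e) = 2" "ends G e \<subseteq> verts G"
      using G by (auto simp: multigraph_def)
    then obtain a b where "ends G e = {a, b}" "a \<in> verts G" "b \<in> verts G"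
      by (auto simp: card_2_iff)
    with e show "e \<in> (\<Union>w\<in>verts G. {e \<in> edges G. ends G e = {w, v}})"
      by (auto simp: insert_commute)
  qed auto
  show ?thesis
    unfolding valence_def * edges_between_def
    using fin by (intro card_UN_disjoint) (auto simp: doubleton_eq_iff)
qed

lemma edges_between_le_1:
  assumes G: "multigraph G" and girth: "enat 2 < girth G"
  shows "edges_between G v w \<le> 1"
proof (rule ccontr)
  assume "\<not> edges_between G v w \<le> 1"
  then have "2 \<le> card {e \<in> edges G. ends G e = {v, w}}"
    by (simp add: edges_between_def)
  then obtain T where T: "T \<subseteq> {e \<in> edges G. ends G e = {v, w}}" "card T = 2"
    by (meson obtain_subset_with_card_n)
  then obtain e f where "T = {e, f}" "e \<noteq> f"
    by (auto simp: card_2_iff)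
  with T have ef: "e \<in> edges G" "f \<in> edges G" "ends G e = {v, w}" "ends G f = {v, w}"
    by auto
  have "v \<noteq> w" "v \<in> verts G" "w \<in> verts G"
    using G ef by (auto simp: multigraph_def)
  then have "is_cycle G [v, w] [e, f]"
    using ef \<open>e \<noteq> f\<close> by (auto simp: is_cycle_def less_Suc_eq)
  then have "girth G \<le> enat (length [e, f])"
    unfolding girth_def by (intro Inf_lower) blast
  with girth show False
    by (simp add: numeral_2_eq_2)
qed

section \<open>Degree, rank and gonality\<close>

lemma deg_fire:
  assumes G: "multigraph G" and v: "v \<in> verts G"
  shows "deg G (fire G v D) = deg G D"
proof -
  have fin: "finite (verts G)"
    using G by (simp add: multigraph_def)
  have "fire G v D w = D w + int (edges_between G w v) - (if w = v then int (valence G v) else 0)" for w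
    using edges_between_self[OF G] by (auto simp: fire_def edges_between_commute)
  then have "deg G (fire G v D) =
      deg G D + int (\<Sum>w\<in>verts G. edges_between G w v) - int (valence G v)"
    using fin v by (simp add: deg_def sum.distrib sum_subtractf)
  then show ?thesis
    by (simp add: valence_eq_sum[OF G])
qed

lemma deg_lin_equiv:
  assumes G: "multigraph G" and "lin_equiv G D D'"
  shows "deg G D' = deg G D"
  using assms(2) unfolding lin_equiv_def
  by (induction rule: rtranclp_induct) (auto simp: deg_fire[OF G])

lemma deg_nonneg_if_equiv_effective:
  assumes "multigraph G" "equiv_effective G D"
  shows "0 \<le> deg G D"
  using assms deg_lin_equiv[OF assms(1)]
  by (metis deg_def effective_def equiv_effective_def sum_nonneg)

text \<open>Placing all \<open>k\<close> chips of \<open>E\<close> on one vertex bounds every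
  admissible \<open>k\<close> by the degree of \<open>D\<close>. So the \<open>GREATEST\<close> in
  the rank ranges over a bounded set, and it dominates \<open>r\<close>.\<close>

lemma le_rankI:
  assumes G: "multigraph G" and D: "equiv_effective G D"
    and r: "\<And>E. effective G E \<Longrightarrow> deg G E = int r \<Longrightarrow> equiv_effective G (\<lambda>v. D v - E v)"
  shows "int r \<le> rank G D"
proof -
  let ?P = "\<lambda>k::nat. \<forall>E. effective G E \<and> deg G E = int k \<longrightarrow> equiv_effective G (\<lambda>v. D v - E v)"
  have fin: "finite (verts G)"
    using G by (simp add: multigraph_def)
  obtain x where x: "x \<in> verts G"
    using G by (auto simp: multigraph_def connected_mgraph_def)
  have "k \<le> nat (deg G D)" if "?P k" for k
  proof -
    let ?E = "\<lambda>v. if v = x then int k else 0"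
    have "effective G ?E" and E: "deg G ?E = int k"
      using x fin by (auto simp: effective_def divisor_def deg_def)
    with that have "0 \<le> deg G (\<lambda>v. D v - ?E v)"
      by (intro deg_nonneg_if_equiv_effective[OF G]) blast
    with E show ?thesis
      by (simp add: deg_def sum_subtractf)
  qed
  then have "r \<le> Greatest ?P"
    using r by (intro Greatest_le_nat[where b = "nat (deg G D)"]) auto
  with D show ?thesis
    by (simp add: rank_def)
qed

text \<open>The integers are not well-ordered, so \<open>LEAST\<close> is meaningful only because
  rank at least 0 forces degree at least 0; the minimum is then found among the naturals.\<close>

lemma gonality_le_deg:
  assumes G: "multigraph G" and D: "divisor G D" "int r \<le> rank G D"
  shows "gonality r G \<le> deg G D"
proof -
  let ?P = "\<lambda>d::int. \<exists>D. divisor G D \<and> int r \<le> rank G D \<and> deg G D = d"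
  have nonneg: "0 \<le> d" if d: "?P d" for d
  proof -
    from d obtain F where F: "int r \<le> rank G F" "deg G F = d"
      by blast
    then have "equiv_effective G F"
      by (auto simp: rank_def split: if_splits)
    with F G show ?thesis
      using deg_nonneg_if_equiv_effective by blast
  qed
  have P: "?P (deg G D)"
    using D by blast
  define k where "k = (LEAST k::nat. ?P (int k))"
  have "?P (int (nat (deg G D)))"
    using nonneg[OF P] P by simp
  then have k: "?P (int k)"
    unfolding k_def by (rule LeastI)
  have least: "int k \<le> d" if "?P d" for d
  proof -
    have "?P (int (nat d))"
      using nonneg[OF that] that by simp
    then have "k \<le> nat d"
      unfolding k_def by (rule Least_le)
    with nonneg[OF that] show ?thesis
      by simp
  qed
  have "gonality r G = int k"
    unfolding gonality_def using k least by (rule Least_equality)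
  with least[OF P] show ?thesis
    by simp
qed

section \<open>Firing sets of vertices\<close>

lemma lin_equiv_fire_set:
  assumes G: "multigraph G" and T: "finite T" "T \<subseteq> verts G"
  shows "lin_equiv G D (\<lambda>x. D x + (\<Sum>v\<in>T. int (edges_between G v x))
           - (if x \<in> T then int (valence G x) else 0))"
proof -
  define F where "F T x = D x + (\<Sum>v\<in>T. int (edges_between G v x))
           - (if x \<in> T then int (valence G x) else 0)" for T x
  have "lin_equiv G D (F T)"
    using T
  proof (induction T rule: finite_induct)
    case empty
    have "F {} = D"
      by (simp add: F_def fun_eq_iff)
    then show ?case
      by (simp add: lin_equiv_def)
  next
    case (insert y T)
    have "F (insert y T) x = fire G y (F T) x" for x
      using insert.hyps edges_between_self[OF G, of y] by (cases "x = y") (simp_all add: fire_def F_def)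
    then have "F (insert y T) = fire G y (F T)"
      by blast
    then have "\<exists>v\<in>verts G. F (insert y T) = fire G v (F T)"
      using insert.prems by blast
    moreover have "lin_equiv G D (F T)"
      using insert by simp
    ultimately show ?case
      unfolding lin_equiv_def by (rule rtranclp.rtrancl_into_rtrancl[rotated])
  qed
  then show ?thesis
    by (simp add: F_def[abs_def])
qed

text \<open>Only forward firings are available, so the complement of \<open>W\<close> fires instead
  of \<open>W\<close> borrowing. Every edge between the two sides then carries one chip into
  \<open>W\<close>, and the two bounds say that no debt remains on either side.\<close>

lemma equiv_effective_fire_complement:
  assumes G: "multigraph G" and W: "W \<subseteq> verts G" and F: "divisor G F"
    and outside: "\<And>x. x \<in> verts G - W \<Longrightarrow> (\<Sum>v\<in>W. int (edges_between G v x)) \<le> F x"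
    and inside: "\<And>x. x \<in> W \<Longrightarrow>
      (\<Sum>v\<in>W. int (edges_between G v x)) \<le> F x + int (valence G x)"
  shows "equiv_effective G F"
proof -
  let ?T = "verts G - W"
  let ?F = "\<lambda>x. F x + (\<Sum>v\<in>?T. int (edges_between G v x))
           - (if x \<in> ?T then int (valence G x) else 0)"
  have fin: "finite (verts G)"
    using G by (simp add: multigraph_def)
  have val: "int (valence G x) =
      (\<Sum>v\<in>W. int (edges_between G v x)) + (\<Sum>v\<in>?T. int (edges_between G v x))" for x
    using sum.subset_diff[OF W fin, of "\<lambda>v. int (edges_between G v x)"]
    by (simp add: valence_eq_sum[OF G] add.commute)
  have "effective G ?F"
    unfolding effective_def divisor_def
  proof (intro conjI allI impI ballI)
    fix x assume "x \<notin> verts G"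
    then show "?F x = 0"
      using F edges_between_outside[OF G] by (simp add: divisor_def)
  next
    fix x assume "x \<in> verts G"
    then show "0 \<le> ?F x"
      using val[of x] inside[of x] outside[of x] by (cases "x \<in> W") auto
  qed
  moreover have "lin_equiv G F ?F"
    using fin by (intro lin_equiv_fire_set[OF G]) auto
  ultimately show ?thesis
    unfolding equiv_effective_def by blast
qed

section \<open>Sets of few vertices induce forests\<close>

abbreviation degree_in :: "('v, 'e) mgraph \<Rightarrow> 'v set \<Rightarrow> 'v \<Rightarrow> int" where
  "degree_in G A x \<equiv> \<Sum>v\<in>A. int (edges_between G v x)"

text \<open>Twice the number of edges inside \<open>A\<close>, as each edge is seen from both ends;
  keeping the factor 2 avoids a division.\<close>

definition degree_sum :: "('v, 'e) mgraph \<Rightarrow> 'v set \<Rightarrow> int" where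
  "degree_sum G A = (\<Sum>x\<in>A. degree_in G A x)"

lemma degree_sum_insert:
  assumes G: "multigraph G" and A: "finite A" "x \<notin> A"
  shows "degree_sum G (insert x A) = degree_sum G A + 2 * degree_in G A x"
proof -
  have "(\<Sum>v\<in>A. int (edges_between G x v)) = degree_in G A x"
    by (simp add: edges_between_commute)
  then show ?thesis
    using A edges_between_self[OF G] by (simp add: degree_sum_def sum.distrib)
qed

text \<open>Without parallel edges, each of the other \<open>card A - 1\<close> vertices contributes
  at most one edge.\<close>

lemma degree_in_le:
  assumes G: "multigraph G" and girth: "enat 2 < girth G" and A: "finite A" "x \<in> A"
  shows "degree_in G A x \<le> int (card A) - 1"
proof -
  have "degree_in G A x = degree_in G (A - {x}) x"
    using A edges_between_self[OF G] by (simp add: sum.remove)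
  also have "\<dots> \<le> (\<Sum>v\<in>A - {x}. 1)"
    using edges_between_le_1[OF G girth] by (intro sum_mono) (simp add: of_nat_le_1_iff)
  finally show ?thesis
    using card.remove[OF A] by simp
qed

section \<open>Paths inside a vertex set\<close>

text \<open>Only vertices are recorded, so paths can be reversed, extended and cut as lists; edges
  are chosen when a walk or a cycle is built.\<close>

definition path_in :: "('v, 'e) mgraph \<Rightarrow> 'v set \<Rightarrow> 'v list \<Rightarrow> bool" where
  "path_in G A p \<longleftrightarrow> p \<noteq> [] \<and> distinct p \<and> set p \<subseteq> A \<and>
     successively (\<lambda>u v. 0 < edges_between G u v) p"

lemma path_in_rev: "path_in G A p \<Longrightarrow> path_in G A (rev p)"
  unfolding path_in_def by (simp add: edges_between_commute successively_rev)

lemma path_in_Cons: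
  assumes "path_in G A p" "x \<in> A - set p" "0 < edges_between G x (hd p)"
  shows "path_in G A (x # p)"
  using assms by (auto simp: path_in_def successively_Cons)

lemma path_in_appendD:
  assumes "path_in G A (p @ q)" "p \<noteq> []"
  shows "path_in G A p"
  using assms by (auto simp: path_in_def successively_append_iff)

lemma walk_along_path:
  assumes "A \<subseteq> verts G" "path_in G A p"
  shows "\<exists>es. walk G (hd p) es (last p) \<and> Suc (length es) = length p"
  using assms(2)
proof (induction p rule: induct_list012)
  case (2 x)
  then have "walk G x [] x"
    using assms(1) by (auto simp: path_in_def)
  then show ?case
    by auto
next
  case (3 x y zs)
  then have "path_in G A (y # zs)" and "0 < edges_between G x y"
    by (auto simp: path_in_def)
  then obtain e where e: "e \<in> edges G" "ends G e = {x, y}"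
    by (auto elim: edges_between_posE)
  obtain es where es: "walk G y es (last (y # zs))" "Suc (length es) = length (y # zs)"
    using "3.IH"(2)[OF \<open>path_in G A (y # zs)\<close>] unfolding list.sel by blast
  have "walk G x (e # es) (last (y # zs))"
    unfolding walk.simps using e es(1) by blast
  with es(2) show ?case
    by (intro exI[of _ "e # es"]) (simp del: walk.simps)
qed (simp add: path_in_def)

lemma gdist_less_length_path:
  assumes "A \<subseteq> verts G" "path_in G A p"
  shows "gdist G (hd p) (last p) < length p"
proof -
  obtain es where "walk G (hd p) es (last p)" "Suc (length es) = length p"
    using walk_along_path[OF assms] by blast
  moreover from this have "gdist G (hd p) (last p) \<le> length es"
    unfolding gdist_def by (intro Least_le) blast
  ultimately show ?thesis
    by simp
qed

lemma girth_le_closed_path: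
  assumes A: "A \<subseteq> verts G" and p: "path_in G A p" and len: "3 \<le> length p"
    and close: "0 < edges_between G (last p) (hd p)"
  shows "girth G \<le> enat (length p)"
proof -
  let ?n = "length p"
  have dist: "distinct p" and p0: "p \<noteq> []"
    using p by (auto simp: path_in_def)
  have "0 < edges_between G (p ! i) (p ! (Suc i mod ?n))" if "i < ?n" for i
  proof (cases "Suc i < ?n")
    case True
    then show ?thesis
      using p by (simp add: path_in_def successively_conv_nth)
  next
    case False
    with that have "i = ?n - 1" "Suc i = ?n"
      by auto
    then show ?thesis
      using close p0 by (simp add: last_conv_nth hd_conv_nth)
  qed
  then have "\<exists>e. e \<in> edges G \<and> ends G e = {p ! i, p ! (Suc i mod ?n)}" if "i < ?n" for i
    using that edges_between_posE by metis
  then obtain f where f: "\<And>i. i < ?n \<Longrightarrow> f i \<in> edges G"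
      "\<And>i. i < ?n \<Longrightarrow> ends G (f i) = {p ! i, p ! (Suc i mod ?n)}"
    by metis
  have "inj_on f {0..<?n}"
  proof (rule inj_onI)
    fix i j assume ij: "i \<in> {0..<?n}" "j \<in> {0..<?n}" "f i = f j"
    then have "{p ! i, p ! (Suc i mod ?n)} = {p ! j, p ! (Suc j mod ?n)}"
      using f(2) by (metis atLeastLessThan_iff)
    moreover have "Suc i mod ?n < ?n" "Suc j mod ?n < ?n"
      using p0 by auto
    ultimately have "i = j \<or> i = Suc j mod ?n \<and> j = Suc i mod ?n"
      using ij dist by (auto simp: doubleton_eq_iff nth_eq_iff_index_eq)
    \<comment> \<open>The swapped alternative would give \<open>i = i + 2\<close> modulo the length,
      impossible for length at least 3.\<close>
    then show "i = j"
      using ij len by (auto simp: mod_Suc split: if_splits)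
  qed
  then have "is_cycle G p (map f [0..<?n])"
    using f p A len by (auto simp: is_cycle_def path_in_def distinct_map)
  then have "girth G \<le> enat (length (map f [0..<?n]))"
    unfolding girth_def by (intro Inf_lower) blast
  then show ?thesis
    by simp
qed

text \<open>By maximality all neighbours of \<open>hd p\<close> within \<open>A\<close> lie on
  \<open>p\<close>. One beyond the second vertex would close a cycle of length at most
  \<open>card A \<le> r + 1\<close>, against the girth. So there is at most one neighbour, and the
  degree condition puts \<open>hd p\<close> in \<open>S\<close>.\<close>

lemma hd_longest_path:
  assumes G: "multigraph G" and girth: "enat (r + 1) < girth G" and r: "1 \<le> r"
    and A: "A \<subseteq> verts G" "card A \<le> r + 1"
    and deg: "\<And>x. x \<in> A \<Longrightarrow> 2 \<le> degree_in G A x + of_bool (x \<in> S)"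
    and p: "path_in G A p" and longest: "\<And>q. path_in G A q \<Longrightarrow> length q \<le> length p"
  shows "hd p \<in> S \<and> 2 \<le> length p"
proof -
  have finA: "finite A"
    using G A by (auto simp: multigraph_def intro: finite_subset)
  have girth2: "enat 2 < girth G"
    using r by (intro le_less_trans[OF _ girth]) simp
  define a where "a = hd p"
  define N where "N = {x \<in> A. 0 < edges_between G x a}"
  have a: "a \<in> A" "p = a # tl p"
    using p by (auto simp: a_def path_in_def)
  have "degree_in G A a = (\<Sum>x\<in>N. int (edges_between G x a))"
    unfolding N_def using finA by (intro sum.mono_neutral_right) auto
  also have "\<dots> \<le> (\<Sum>x\<in>N. 1)"
    using edges_between_le_1[OF G girth2] by (intro sum_mono) (simp add: of_nat_le_1_iff)
  finally have cardN: "2 \<le> int (card N) + of_bool (a \<in> S)"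
    using deg[OF a(1)] by simp
  have aN: "a \<notin> N"
    using edges_between_self[OF G] by (simp add: N_def)
  have N: "N \<subseteq> set (tl p)"
  proof
    fix x assume x: "x \<in> N"
    have "x \<in> set p"
    proof (rule ccontr)
      assume "x \<notin> set p"
      then have "path_in G A (x # p)"
        using x p by (intro path_in_Cons) (auto simp: N_def a_def)
      then show False
        using longest by fastforce
    qed
    with x aN a(2) show "x \<in> set (tl p)"
      by (metis set_ConsD)
  qed
  \<comment> \<open>Membership in \<open>S\<close> accounts for at most 1 of the required 2, so a
    neighbour exists, and with it a second vertex of \<open>p\<close>.\<close>
  obtain b where "b \<in> N"
    using cardN by (cases "N = {}"; cases "a \<in> S") auto
  then obtain c q where tl: "tl p = c # q"
    using N by (cases "tl p") auto
  have "N \<subseteq> {c}"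
  proof
    fix x assume x: "x \<in> N"
    show "x \<in> {c}"
    proof (rule ccontr)
      assume "x \<notin> {c}"
      with x N tl obtain ys zs where "q = ys @ x # zs"
        by (metis in_mono set_ConsD singletonI split_list)
      with tl a(2) have split: "p = (a # c # ys @ [x]) @ zs"
        by simp
      let ?q = "a # c # ys @ [x]"
      have q: "path_in G A ?q"
        using p unfolding split by (rule path_in_appendD) simp
      have "girth G \<le> enat (length ?q)"
        using x by (intro girth_le_closed_path[OF A(1) q]) (auto simp: N_def)
      moreover have "length ?q \<le> card A"
        using q finA by (metis card_mono distinct_card path_in_def)
      then have "enat (length ?q) \<le> enat (r + 1)"
        using A(2) by simp
      ultimately have "girth G \<le> enat (r + 1)"
        by (rule order_trans)
      with girth show False
        by simp
    qed
  qed
  then have "card N \<le> 1"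
    using card_mono[of "{c}" N] by simp
  with cardN have "a \<in> S"
    by (cases "a \<in> S") auto
  moreover have "2 \<le> length p"
    using tl by (cases p) auto
  ultimately show ?thesis
    by (simp add: a_def)
qed

text \<open>Identifying the vertices of \<open>S\<close> with one another creates no cycle inside \<open>A\<close>: in a minimal
  counterexample every vertex outside \<open>S\<close> has degree at least 2 and every vertex of \<open>S\<close> has degree
  at least 1, so a longest path closes up to a short cycle or joins two vertices of \<open>S\<close>.\<close>

lemma card_Int_plus_edges_le_card:
  assumes G: "multigraph G" and girth: "enat (r + 1) < girth G" and r: "1 \<le> r"
    and S: "\<And>u v. u \<in> S \<Longrightarrow> v \<in> S \<Longrightarrow> u \<noteq> v \<Longrightarrow> r < gdist G u v"
    and A: "A \<subseteq> verts G" "card A \<le> r + 1"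
  shows "2 * int (card (A \<inter> S)) + degree_sum G A \<le> 2 * int (card A)"
  using A
proof (induction "card A" arbitrary: A rule: less_induct)
  case less
  have finA: "finite A"
    using G less.prems by (auto simp: multigraph_def intro: finite_subset)
  show ?case
  proof (cases "\<exists>x\<in>A. degree_in G A x + of_bool (x \<in> S) \<le> 1")
    case True
    then obtain x where x: "x \<in> A" "degree_in G A x + of_bool (x \<in> S) \<le> 1"
      by blast
    define B where "B = A - {x}"
    have B: "A = insert x B" "x \<notin> B" "finite B" "B \<subseteq> verts G"
      using x less.prems finA by (auto simp: B_def)
    \<comment> \<open>Deleting \<open>x\<close> lowers the right side by exactly 2 and the left side
      by at most 2.\<close>
    have "2 * int (card (B \<inter> S)) + degree_sum G B \<le> 2 * int (card B)"
      using B less.prems by (intro less.hyps) auto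
    moreover have "degree_in G A x = degree_in G B x"
      using B edges_between_self[OF G] by simp
    ultimately show ?thesis
      using x(2) B by (cases "x \<in> S") (auto simp: degree_sum_insert[OF G])
  next
    case False
    then have deg: "\<And>x. x \<in> A \<Longrightarrow> 2 \<le> degree_in G A x + of_bool (x \<in> S)"
      by force
    have "A = {}"
    proof (rule ccontr)
      assume "A \<noteq> {}"
      then obtain x where "path_in G A [x]"
        by (auto simp: path_in_def)
      moreover have bound: "length q \<le> card A" if "path_in G A q" for q
        using that finA by (metis card_mono distinct_card path_in_def)
      then have "\<forall>q. path_in G A q \<longrightarrow> length q < Suc (card A)"
        by (simp add: less_Suc_eq_le)
      ultimately obtain p where p: "path_in G A p"
        and longest: "\<And>q. path_in G A q \<Longrightarrow> length q \<le> length p"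
        using ex_has_greatest_nat[of "path_in G A" "[x]" length] by blast
      note hd = hd_longest_path[OF G girth r less.prems deg]
      have "hd p \<in> S" "2 \<le> length p"
        using hd[OF _ p longest] by auto
      \<comment> \<open>Reversal keeps the length, so \<open>rev p\<close> is longest too and the
        other end also lies in \<open>S\<close>.\<close>
      moreover have "hd (rev p) \<in> S"
        using hd[OF _ path_in_rev[OF p]] longest by simp
      moreover have "hd p \<noteq> last p"
        using p \<open>2 \<le> length p\<close> by (cases p) (auto simp: path_in_def)
      ultimately have "r < gdist G (hd p) (last p)"
        by (intro S) (auto simp: hd_rev)
      \<comment> \<open>A path has one edge fewer than vertices; this strictness leaves no room
        between \<open>r\<close> and \<open>r + 1\<close>.\<close>
      moreover have "gdist G (hd p) (last p) < length p"
        using less.prems(1) p by (rule gdist_less_length_path)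
      moreover have "length p \<le> r + 1"
        using bound[OF p] less.prems(2) by simp
      ultimately show False
        by simp
    qed
    then show ?thesis
      by (simp add: degree_sum_def)
  qed
qed

section \<open>Burning\<close>

text \<open>\<open>A\<close> can be burnt vertex by vertex: a vertex burns as soon as its burnt edges outnumber
  its chips \<open>F\<close>, and \<open>A - B\<close> is the part burnt so far.\<close>

definition burnable :: "('v, 'e) mgraph \<Rightarrow> ('v \<Rightarrow> int) \<Rightarrow> 'v set \<Rightarrow> bool" where
  "burnable G F A \<longleftrightarrow> (\<forall>B\<subseteq>A. B \<noteq> {} \<longrightarrow> (\<exists>w\<in>B. F w < degree_in G (A - B) w))"

text \<open>If \<open>B\<close> misses \<open>A\<close>, it is \<open>{w}\<close> and all of
  \<open>A\<close> has burnt. Otherwise a vertex of \<open>B \<inter> A\<close> that burns from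
  \<open>A - B\<close> still burns when \<open>w\<close> is possibly added to the burnt
  part.\<close>

lemma burnable_insert:
  assumes "finite A" "burnable G F A" "F w < degree_in G A w"
  shows "burnable G F (insert w A)"
  unfolding burnable_def
proof (intro allI impI)
  fix B assume B: "B \<subseteq> insert w A" "B \<noteq> {}"
  show "\<exists>x\<in>B. F x < degree_in G (insert w A - B) x"
  proof (cases "B \<inter> A = {}")
    case True
    then have "w \<in> B" "A \<subseteq> insert w A - B"
      using B by auto
    then have "degree_in G A w \<le> degree_in G (insert w A - B) w"
      using assms(1) by (intro sum_mono2) auto
    with \<open>w \<in> B\<close> assms(3) show ?thesis
      by force
  next
    case False
    then obtain x where x: "x \<in> B \<inter> A" "F x < degree_in G (A - (B \<inter> A)) x"
      using assms(2) unfolding burnable_def by (meson inf_le2)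
    have "degree_in G (A - (B \<inter> A)) x \<le> degree_in G (insert w A - B) x"
      using assms(1) by (intro sum_mono2) auto
    with x show ?thesis
      by force
  qed
qed

text \<open>The vertices of \<open>B\<close> burn one at a time after \<open>W - B\<close>. Each
  \<open>x\<close> uses at least \<open>F x + 1\<close> edges to vertices already burnt, and every
  edge inside \<open>W\<close> but not inside \<open>W - B\<close> is counted once, at its later
  end.\<close>

lemma burnable_sum_le:
  assumes G: "multigraph G" and W: "finite W" "burnable G F W" and B: "B \<subseteq> W"
  shows "2 * (\<Sum>x\<in>B. F x) + 2 * int (card B) \<le> degree_sum G W - degree_sum G (W - B)"
  using B
proof (induction "card B" arbitrary: B)
  case 0
  then have "B = {}"
    using W(1) by (metis card_0_eq finite_subset)
  then show ?case
    by simp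
next
  case (Suc n)
  then have "B \<noteq> {}" and finB: "finite B"
    using W(1) by (auto intro: finite_subset)
  then obtain w where w: "w \<in> B" "F w < degree_in G (W - B) w"
    using W(2) Suc.prems unfolding burnable_def by blast
  \<comment> \<open>\<open>w\<close> is the first vertex of \<open>B\<close> to burn; the rest
    \<open>C\<close> burns after \<open>W - C\<close>.\<close>
  define C where "C = B - {w}"
  have C: "B = insert w C" "w \<notin> C" "finite C" "C \<subseteq> W"
    using w finB Suc.prems by (auto simp: C_def)
  have "W - C = insert w (W - B)" "w \<notin> W - B"
    using C Suc.prems by auto
  then have "degree_sum G (W - C) = degree_sum G (W - B) + 2 * degree_in G (W - B) w"
    using degree_sum_insert[OF G, of "W - B" w] W(1) by simp
  moreover have "2 * (\<Sum>x\<in>C. F x) + 2 * int (card C) \<le> degree_sum G W - degree_sum G (W - C)"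
    using Suc.hyps C by (intro Suc.hyps(1)) auto
  ultimately show ?case
    using w(2) C by simp
qed

lemma finite_maximal_set:
  assumes "finite V" "P A\<^sub>0" "A\<^sub>0 \<subseteq> V"
  obtains W where "W \<subseteq> V" "P W" "\<And>x. x \<in> V - W \<Longrightarrow> \<not> P (insert x W)"
proof -
  have "finite {A. A \<subseteq> V \<and> P A}" "{A. A \<subseteq> V \<and> P A} \<noteq> {}"
    using assms by auto
  then obtain W where W: "W \<subseteq> V" "P W" "\<And>A. A \<subseteq> V \<Longrightarrow> P A \<Longrightarrow> W \<subseteq> A \<Longrightarrow> W = A"
    using finite_has_maximal[of "{A. A \<subseteq> V \<and> P A}"] by auto
  show ?thesis
    using W by (intro that[of W]) blast+
qed

section \<open>Removing \<open>r\<close> chips from the complement of \<open>S\<close>\<close>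

lemma equiv_effective_complement_minus:
  assumes G: "multigraph G" and girth: "enat (r + 1) < girth G" and r: "1 \<le> r"
    and val: "r \<le> min_valence G"
    and S: "\<And>u v. u \<in> S \<Longrightarrow> v \<in> S \<Longrightarrow> u \<noteq> v \<Longrightarrow> r < gdist G u v"
    and E: "effective G E" "deg G E = int r"
  shows "equiv_effective G (\<lambda>v. of_bool (v \<in> verts G - S) - E v)"
proof -
  let ?V = "verts G"
  define D :: "'a \<Rightarrow> int" where "D = (\<lambda>v. of_bool (v \<in> ?V - S))"
  define F where "F = (\<lambda>v. D v - E v)"
  have fin: "finite ?V"
    using G by (simp add: multigraph_def)
  have girth2: "enat 2 < girth G"
    using r by (intro le_less_trans[OF _ girth]) simp
  have divF: "divisor G F"
    using E(1) by (simp add: F_def D_def effective_def divisor_def)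
  have sumE: "sum E A \<le> int r" if "A \<subseteq> ?V" for A
    using E fin that unfolding deg_def effective_def
    by (metis Diff_iff sum_mono2)
  have sumD: "sum D A = int (card A) - int (card (A \<inter> S))" if "A \<subseteq> ?V" for A
  proof -
    have "finite A"
      using that fin finite_subset by blast
    have "sum D A = (\<Sum>v\<in>A. 1 - of_bool (v \<in> S))"
      using that by (intro sum.cong) (auto simp: D_def)
    then show ?thesis
      using \<open>finite A\<close> by (simp add: sum_subtractf Int_def)
  qed
  \<comment> \<open>The cap \<open>r\<close> keeps any one-vertex extension within the
    \<open>r + 1\<close> vertices of the forest bound; \<open>closed\<close> shows that the cap is
    never what stops the fire.\<close>
  define P where "P = (\<lambda>A. card A \<le> r \<and> burnable G F A)"
  have "P {}"
    by (simp add: P_def burnable_def)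
  then obtain W where W: "W \<subseteq> ?V" "P W" and maximal: "\<And>x. x \<in> ?V - W \<Longrightarrow> \<not> P (insert x W)"
    using finite_maximal_set[OF fin, of P "{}"] by auto
  have finW: "finite W"
    using W(1) fin by (rule finite_subset)
  have burnW: "burnable G F W" and cardW: "card W \<le> r"
    using W(2) by (auto simp: P_def)
  have closed: "degree_in G W w \<le> F w" if w: "w \<in> ?V - W" for w
  proof (rule ccontr)
    assume "\<not> ?thesis"
    then have burn: "burnable G F (insert w W)"
      using finW burnW by (intro burnable_insert) auto
    let ?A = "insert w W"
    have A: "?A \<subseteq> ?V" "card ?A \<le> r + 1"
      using w W(1) finW cardW by auto
    have "2 * int (card (?A \<inter> S)) + degree_sum G ?A \<le> 2 * int (card ?A)"
      by (rule card_Int_plus_edges_le_card[OF G girth r S A])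
    moreover have "2 * sum F ?A + 2 * int (card ?A) \<le> degree_sum G ?A"
      using burnable_sum_le[OF G _ burn, of ?A] finW by (simp add: degree_sum_def)
    moreover have "sum F ?A = sum D ?A - sum E ?A"
      unfolding F_def by (rule sum_subtractf)
    \<comment> \<open>The two counts leave \<open>sum F ?A \<le> - card (?A \<inter> S)\<close>,
      while \<open>sum F ?A\<close> equals
      \<open>card ?A - card (?A \<inter> S) - sum E ?A\<close>.\<close>
    ultimately have "int (card ?A) \<le> sum E ?A"
      using sumD[OF A(1)] by linarith
    then have "card ?A \<le> r"
      using sumE[OF A(1)] by linarith
    then show False
      using maximal[OF w] burn by (simp add: P_def)
  qed
  have "equiv_effective G F"
  proof (rule equiv_effective_fire_complement[OF G W(1) divF])
    fix x assume "x \<in> ?V - W"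
    then show "degree_in G W x \<le> F x"
      by (rule closed)
  next
    fix u assume u: "u \<in> W"
    \<comment> \<open>Counting over all burnt vertices but \<open>u\<close> bounds \<open>E\<close>
      on them from below, hence \<open>E u\<close> from above.\<close>
    define B where "B = W - {u}"
    have B: "W = insert u B" "u \<notin> B" "finite B" "W - B = {u}"
      using u finW by (auto simp: B_def)
    have "2 * int (card (W \<inter> S)) + degree_sum G W \<le> 2 * int (card W)"
      using card_Int_plus_edges_le_card[OF G girth r S W(1)] cardW by simp
    moreover have "degree_sum G {u} = 0"
      using edges_between_self[OF G] by (simp add: degree_sum_def)
    then have "2 * sum F B + 2 * int (card B) \<le> degree_sum G W"
      using burnable_sum_le[OF G finW burnW, of B] B by auto
    moreover have "sum F B = sum D B - sum E B"
      unfolding F_def by (rule sum_subtractf)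
    moreover have "sum D W = D u + sum D B" "sum E W = E u + sum E B" "card W = Suc (card B)"
      using B by auto
    moreover have "degree_in G W u \<le> int (card W) - 1"
      using G girth2 finW u by (rule degree_in_le)
    moreover have "r \<le> valence G u"
      using val u W(1) fin unfolding min_valence_def
      by (metis Min_le finite_imageI imageI le_trans subsetD)
    \<comment> \<open>The count gives \<open>- F u \<le> r - (card W - 1)\<close>. At least that
      many edges leave \<open>W\<close> at \<open>u\<close>, as at most \<open>card W - 1\<close> of
      its edges stay inside.\<close>
    ultimately show "degree_in G W u \<le> F u + int (valence G u)"
      using sumD[OF W(1)] sumE[OF W(1)] by (simp add: F_def)
  qed
  then show ?thesis
    by (simp add: F_def D_def)
qed

section \<open>The bound on the gonality\<close>

lemma indep_number_attained:
  assumes "finite (verts G)"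
  obtains S where "S \<subseteq> verts G" "\<And>u v. u \<in> S \<Longrightarrow> v \<in> S \<Longrightarrow> u \<noteq> v \<Longrightarrow> k < gdist G u v"
    "card S = indep_number k G"
proof -
  let ?X = "{card S | S. S \<subseteq> verts G \<and> (\<forall>u\<in>S. \<forall>v\<in>S. u \<noteq> v \<longrightarrow> k < gdist G u v)}"
  have "?X \<subseteq> card ` Pow (verts G)"
    by auto
  then have "finite ?X"
    using assms by (meson finite_Pow_iff finite_imageI finite_subset)
  moreover have "?X \<noteq> {}"
    by blast
  ultimately have "indep_number k G \<in> ?X"
    unfolding indep_number_def by (rule Max_in)
  with that show ?thesis
    by auto
qed

theorem theorem1p2:
  fixes G :: "('v, 'e) mgraph" and r n :: nat
  assumes "1 \<le> r"
    and "multigraph G"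
    and "card (verts G) = n"
    and "r \<le> min_valence G"
    and "enat (r + 1) < girth G"
  shows "gonality r G \<le> int n - int (indep_number r G)"
proof -
  have fin: "finite (verts G)"
    using assms(2) by (simp add: multigraph_def)
  obtain S where S: "S \<subseteq> verts G" "card S = indep_number r G"
    and indep: "\<And>u v. u \<in> S \<Longrightarrow> v \<in> S \<Longrightarrow> u \<noteq> v \<Longrightarrow> r < gdist G u v"
    using indep_number_attained[OF fin] by metis
  define D :: "'v \<Rightarrow> int" where "D = (\<lambda>v. of_bool (v \<in> verts G - S))"
  have D: "effective G D"
    by (simp add: D_def effective_def divisor_def)
  then have "equiv_effective G D"
    unfolding equiv_effective_def lin_equiv_def by blast
  then have "int r \<le> rank G D"
    using equiv_effective_complement_minus[OF assms(2,5,1,4) indep]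
    by (intro le_rankI[OF assms(2)]) (auto simp: D_def)
  then have "gonality r G \<le> deg G D"
    using D by (intro gonality_le_deg[OF assms(2)]) (auto simp: effective_def)
  also have "deg G D = int (card (verts G - S))"
    using fin by (simp add: deg_def D_def Int_def set_diff_eq)
  also have "\<dots> = int n - int (indep_number r G)"
    using S fin assms(3) card_mono[OF fin S(1)]
    by (simp add: card_Diff_subset finite_subset of_nat_diff)
  finally show ?thesis .
qed

end
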